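(* Let $k,\ell,n\ge 1$ be integers. If each vertex of the graph $K_{\ell}\times P_n$ is colored uniformly and independently with one of $k$ colors, the expected number of blocks (the expected size of the resulting $k$-colored partition) is $$\mathbb{E}[X_k(K_{\ell}\times P_n)]=\frac{k^{\ell n-(2\ell -1)}\left(\left(k^{2\ell}-(k^2-1)^{\ell}\right)+(k-1)^{\ell}\left((k+1)^{\ell}-k^{\ell}\right)n\right)}{k^{\ell n}}.$$
   Context: $K_\ell$ is the complete graph on $\ell$ vertices and $P_n$ the path graph on $n$ vertices. The product $G_1\times G_2$ of graphs $G_1=(V_1,E_1)$, $G_2=(V_2,E_2)$ is the Cartesian product: its vertex set is $V_1\times V_2$, and $(v_1,v_2),(w_1,w_2)$ are adjacent iff ($v_1=w_1$ and $\{v_2,w_2\}\in E_2$) or ($v_2=w_2$ and $\{v_1,w_1\}\in E_1$). Given a coloring of the vertices of a finite graph $G$ with $k$ colors, the blocks are the connected components of the subgraph of $G$ formed by all vertices and all edges whose two endpoints have the same color. $X_k(G)$ denotes the number of blocks when each vertex of $G$ receives independently a uniformly random color among $k$ colors. *)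

theory Defs
  imports "HOL-Probability.Probability" "HOL-Probability.Product_PMF"
begin

record 'a ugraph =
  verts :: "'a set"
  edges :: "'a set set"

definition simple_graph :: "'a ugraph \<Rightarrow> bool" where
  "simple_graph G \<longleftrightarrow> (\<forall>e\<in>edges G. e \<subseteq> verts G \<and> card e = 2)"

definition complete_ugraph :: "nat \<Rightarrow> nat ugraph" where
  "complete_ugraph l = \<lparr>verts = {..<l}, edges = {{u, v} | u v. u < l \<and> v < l \<and> u \<noteq> v}\<rparr>"

definition path_ugraph :: "nat \<Rightarrow> nat ugraph" where
  "path_ugraph n = \<lparr>verts = {..<n}, edges = {{i, Suc i} | i. Suc i < n}\<rparr>"

definition cartesian_product :: "'a ugraph \<Rightarrow> 'b ugraph \<Rightarrow> ('a \<times> 'b) ugraph" where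
  "cartesian_product G H =
    \<lparr>verts = verts G \<times> verts H,
     edges = {{(v1, v2), (w1, w2)} | v1 v2 w1 w2.
                (v1, v2) \<in> verts G \<times> verts H \<and> (w1, w2) \<in> verts G \<times> verts H \<and>
                (v1 = w1 \<and> {v2, w2} \<in> edges H \<or> v2 = w2 \<and> {v1, w1} \<in> edges G)}\<rparr>"

definition connected_components :: "'a ugraph \<Rightarrow> 'a set set" where
  "connected_components G =
    {{w \<in> verts G. (v, w) \<in> {(x, y). {x, y} \<in> edges G}\<^sup>*} | v. v \<in> verts G}"

definition monochromatic_subgraph :: "'a ugraph \<Rightarrow> ('a \<Rightarrow> 'c) \<Rightarrow> 'a ugraph" where
  "monochromatic_subgraph G c =
    \<lparr>verts = verts G, edges = {e \<in> edges G. \<forall>x\<in>e. \<forall>y\<in>e. c x = c y}\<rparr>"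

definition blocks :: "'a ugraph \<Rightarrow> ('a \<Rightarrow> 'c) \<Rightarrow> 'a set set" where
  "blocks G c = connected_components (monochromatic_subgraph G c)"

text \<open>Colors are the elements of \<open>{..<k}\<close>. The value \<open>undefined\<close> given to points that are not
  vertices is irrelevant, since \<^const>\<open>blocks\<close> only looks at colors of vertices.\<close>

definition random_coloring :: "nat \<Rightarrow> 'a ugraph \<Rightarrow> ('a \<Rightarrow> nat) pmf" where
  "random_coloring k G = Pi_pmf (verts G) undefined (\<lambda>_. pmf_of_set {..<k})"

definition expected_blocks :: "nat \<Rightarrow> 'a ugraph \<Rightarrow> real" where
  "expected_blocks k G =
    measure_pmf.expectation (random_coloring k G) (\<lambda>c. real (card (blocks G c)))"

lemma simple_graph_complete_ugraph: "simple_graph (complete_ugraph l)"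
  by (auto simp: simple_graph_def complete_ugraph_def)

lemma simple_graph_path_ugraph: "simple_graph (path_ugraph n)"
  by (auto simp: simple_graph_def path_ugraph_def)

lemma adjacent_cartesian_product:
  assumes "simple_graph G" "simple_graph H"
  shows "{(v1, v2), (w1, w2)} \<in> edges (cartesian_product G H) \<longleftrightarrow>
    v1 = w1 \<and> v1 \<in> verts G \<and> {v2, w2} \<in> edges H \<or>
    v2 = w2 \<and> v2 \<in> verts H \<and> {v1, w1} \<in> edges G"
  using assms unfolding simple_graph_def cartesian_product_def
  by (fastforce simp: doubleton_eq_iff insert_commute)

lemma simple_graph_cartesian_product:
  assumes "simple_graph G" "simple_graph H"
  shows "simple_graph (cartesian_product G H)"
  using assms by (fastforce simp: simple_graph_def cartesian_product_def card_insert_if)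

end

theory Submission
  imports Defs
begin

text \<open>Vertices of the same color in one column of \<open>K\<^sub>l \<times> P\<^sub>n\<close> are pairwise adjacent, so a block is a
  chain of nonempty classes (column, color) with a fixed color and consecutive columns. Each block
  therefore has a unique leftmost class, and the number of blocks is the number of nonempty classes
  minus the number of pairs of consecutive classes joined by a monochromatic path edge. A class is
  nonempty with probability \<open>1 - (1 - 1/k)\<^sup>l\<close>, a consecutive pair of classes of a given color is
  joined with probability \<open>1 - (1 - 1/k\<^sup>2)\<^sup>l\<close>, and linearity of expectation gives the formula.\<close>

section \<open>Counting the blocks of a fixed coloring\<close>

lemma edge_monochromatic_complete_path:
  "{(i, j), (i', j')} \<in> edges (monochromatic_subgraph
      (cartesian_product (complete_ugraph l) (path_ugraph n)) c) \<longleftrightarrow>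
    c (i, j) = c (i', j') \<and> i < l \<and> i' < l \<and> j < n \<and> j' < n \<and>
    (i = i' \<and> (j' = Suc j \<or> j = Suc j') \<or> j = j' \<and> i \<noteq> i')"
proof -
  have "{(i, j), (i', j')} \<in> edges (cartesian_product (complete_ugraph l) (path_ugraph n)) \<longleftrightarrow>
    i < l \<and> i' < l \<and> j < n \<and> j' < n \<and>
    (i = i' \<and> (j' = Suc j \<or> j = Suc j') \<or> j = j' \<and> i \<noteq> i')"
    unfolding adjacent_cartesian_product[OF simple_graph_complete_ugraph simple_graph_path_ugraph]
    by (auto simp: complete_ugraph_def path_ugraph_def doubleton_eq_iff)
  then show ?thesis
    by (auto simp: monochromatic_subgraph_def)
qed

text \<open>Sending a block to its leftmost class is a bijection onto the nonempty classes with no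
  joined class on their left. The count is stated additively because subtraction on
  \<open>nat\<close> truncates; \<open>col\<close> ensures that every color in use is among those
  counted.\<close>

lemma card_blocks_complete_path:
  fixes c :: "nat \<times> nat \<Rightarrow> nat"
  assumes col: "\<And>i j. i < l \<Longrightarrow> j < n \<Longrightarrow> c (i, j) < k"
  shows "card (blocks (cartesian_product (complete_ugraph l) (path_ugraph n)) c)
      + card {(j, a). j < n - 1 \<and> a < k \<and> (\<exists>i<l. c (i, j) = a \<and> c (i, Suc j) = a)}
    = card {(j, a). j < n \<and> a < k \<and> (\<exists>i<l. c (i, j) = a)}"
proof -
  let ?G = "cartesian_product (complete_ugraph l) (path_ugraph n)"
  define R where "R = {(x, y). {x, y} \<in> edges (monochromatic_subgraph ?G c)}"
  define V where "V = {..<l} \<times> {..<n}"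
  define comp where "comp v = {w \<in> V. (v, w) \<in> R\<^sup>*}" for v
  define P where "P = {(j, a). j < n \<and> a < k \<and> (\<exists>i<l. c (i, j) = a)}"
  define Q where "Q = {(j, a). j < n - 1 \<and> a < k \<and> (\<exists>i<l. c (i, j) = a \<and> c (i, Suc j) = a)}"
  \<comment> \<open>\<open>Q\<close> records a joined pair by its left column; the shift turns it
    into the right class of the pair. Thus \<open>S\<close> consists of the classes at which a block
    starts.\<close>
  define Q' where "Q' = (\<lambda>(j, a). (Suc j, a)) ` Q"
  define S where "S = P - Q'"
  have R_iff: "((i, j), (i', j')) \<in> R \<longleftrightarrow>
      c (i, j) = c (i', j') \<and> i < l \<and> i' < l \<and> j < n \<and> j' < n \<and>
      (i = i' \<and> (j' = Suc j \<or> j = Suc j') \<or> j = j' \<and> i \<noteq> i')" for i j i' j'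
    unfolding R_def by (simp add: edge_monochromatic_complete_path)
  have "sym R"
    unfolding R_def sym_def by (simp add: insert_commute)
  then have symR: "(x, y) \<in> R\<^sup>* \<Longrightarrow> (y, x) \<in> R\<^sup>*" for x y
    using sym_rtrancl symD by metis
  have blocks_eq: "blocks ?G c = comp ` V"
    unfolding blocks_def connected_components_def comp_def V_def R_def
    by (auto simp: monochromatic_subgraph_def cartesian_product_def complete_ugraph_def
        path_ugraph_def)
  have comp_eq: "comp v = comp w" if "(v, w) \<in> R\<^sup>*" for v w
    using that symR[OF that] unfolding comp_def by (blast intro: rtrancl_trans)
  have same_column: "((i, j), (i', j)) \<in> R\<^sup>*"
    if "i < l" "i' < l" "j < n" "c (i, j) = c (i', j)" for i i' j
    using that by (cases "i = i'") (auto simp: R_iff)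
  have reach: "w \<in> V \<and> c w = c v" if "(v, w) \<in> R\<^sup>*" "v \<in> V" for v w
    using that by (induction rule: rtrancl_induct) (auto simp: V_def R_iff)
  have Q'_iff: "(Suc j, a) \<in> Q' \<longleftrightarrow>
      Suc j < n \<and> a < k \<and> (\<exists>i<l. c (i, j) = a \<and> c (i, Suc j) = a)" for j a
    by (auto simp: Q'_def Q_def image_iff)
  \<comment> \<open>A walk that first goes left of column \<open>j\<close> must use a path edge from
    column \<open>j\<close> to the one before it, inside color \<open>a\<close>. That edge would put
    \<open>(j, a)\<close> into \<open>Q'\<close>.\<close>
  have leftmost: "j \<le> snd w" if "((i, j), w) \<in> R\<^sup>*" "(j, a) \<in> S" "i < l" "c (i, j) = a" for i j a w
    using that(1)
  proof (induction rule: rtrancl_induct)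
    case base
    then show ?case by simp
  next
    case (step y z)
    have v: "(i, j) \<in> V"
      using that(2,3) by (auto simp: S_def P_def V_def)
    obtain p q where y: "y = (p, q)" by fastforce
    obtain p' q' where z: "z = (p', q')" by fastforce
    have yV: "p < l" "q < n" "c (p, q) = a"
      using reach[OF step.hyps(1) v] that(4) by (auto simp: y V_def)
    have "j \<le> q" using step.IH y by simp
    show ?case
    proof (rule ccontr)
      assume "\<not> j \<le> snd z"
      with step.hyps(2) \<open>j \<le> q\<close> have "q = Suc q'" "p' = p" "j = Suc q'" "c (p, q') = a"
        using yV by (auto simp: y z R_iff)
      then have "(j, a) \<in> Q'"
        using yV col[of p q] by (auto simp: Q'_iff)
      with that(2) show False by (simp add: S_def)
    qed
  qed
  have "\<forall>x\<in>S. \<exists>i<l. c (i, fst x) = snd x"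
    by (auto simp: S_def P_def)
  \<comment> \<open>\<open>r\<close> picks the row of one vertex in each class of \<open>S\<close>;
    by \<open>same_column\<close> the component does not depend on this choice.\<close>
  then obtain r where r: "\<And>j a. (j, a) \<in> S \<Longrightarrow> r (j, a) < l \<and> c (r (j, a), j) = a"
    by (metis fst_conv snd_conv)
  have S_lt: "j < n" if "(j, a) \<in> S" for j a
    using that by (auto simp: S_def P_def)
  have "bij_betw (\<lambda>(j, a). comp (r (j, a), j)) S (comp ` V)"
    unfolding bij_betw_def
  proof
    show "inj_on (\<lambda>(j, a). comp (r (j, a), j)) S"
    proof (rule inj_onI, clarify)
      fix j a j' a'
      assume s: "(j, a) \<in> S" and s': "(j', a') \<in> S"
        and eq: "comp (r (j, a), j) = comp (r (j', a'), j')"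
      have v: "(r (j, a), j) \<in> V" and v': "(r (j', a'), j') \<in> V"
        using r[OF s] r[OF s'] S_lt[OF s] S_lt[OF s'] by (auto simp: V_def)
      have "(r (j', a'), j') \<in> comp (r (j', a'), j')"
        using v' by (simp add: comp_def)
      then have p: "((r (j, a), j), (r (j', a'), j')) \<in> R\<^sup>*"
        unfolding eq[symmetric] by (simp add: comp_def)
      \<comment> \<open>Reachability is symmetric, so \<open>leftmost\<close> can be applied from
        either end.\<close>
      have "j \<le> j'" using leftmost[OF p s] r[OF s] by simp
      moreover have "j' \<le> j" using leftmost[OF symR[OF p] s'] r[OF s'] by simp
      moreover have "a = a'" using reach[OF p v] r[OF s] r[OF s'] by simp
      ultimately show "j = j' \<and> a = a'" by simp
    qed
    show "(\<lambda>(j, a). comp (r (j, a), j)) ` S = comp ` V"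
    proof
      show "(\<lambda>(j, a). comp (r (j, a), j)) ` S \<subseteq> comp ` V"
        using r S_lt by (fastforce simp: V_def)
      show "comp ` V \<subseteq> (\<lambda>(j, a). comp (r (j, a), j)) ` S"
      proof (rule image_subsetI)
        fix v assume v: "v \<in> V"
        \<comment> \<open>The class sought is the one in the least column that the block of
          \<open>v\<close> reaches. If it lay in \<open>Q'\<close>, a walk within the column
          followed by one path edge would reach the column before it.\<close>
        define L where "L j \<longleftrightarrow> (\<exists>i. (v, (i, j)) \<in> R\<^sup>*)" for j
        define j where "j = (LEAST j. L j)"
        have "L (snd v)" unfolding L_def by (intro exI[of _ "fst v"]) simp
        then have "L j" unfolding j_def by (rule LeastI)
        then obtain i where i: "(v, (i, j)) \<in> R\<^sup>*" by (auto simp: L_def)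
        define a where "a = c v"
        have ij: "i < l" "j < n" "c (i, j) = a"
          using reach[OF i v] by (auto simp: V_def a_def)
        have "(j, a) \<notin> Q'"
        proof
          assume q: "(j, a) \<in> Q'"
          then obtain j0 where j0: "j = Suc j0" by (auto simp: Q'_def)
          with q obtain i2 where i2: "i2 < l" "c (i2, j0) = a" "c (i2, j) = a"
            by (auto simp: Q'_iff)
          have "((i, j), (i2, j)) \<in> R\<^sup>*" using same_column ij i2 by simp
          moreover have "((i2, j), (i2, j0)) \<in> R" using ij i2 j0 by (simp add: R_iff)
          ultimately have "(v, (i2, j0)) \<in> R\<^sup>*"
            using i by (meson rtrancl.rtrancl_into_rtrancl rtrancl_trans)
          then have "L j0" by (auto simp: L_def)
          then have "j \<le> j0" unfolding j_def by (rule Least_le)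
          with j0 show False by simp
        qed
        then have s: "(j, a) \<in> S"
          using ij col[of i j] by (auto simp: S_def P_def)
        have "((i, j), (r (j, a), j)) \<in> R\<^sup>*"
          using same_column ij r[OF s] by simp
        then have "comp v = comp (r (j, a), j)"
          using i comp_eq rtrancl_trans by metis
        then show "comp v \<in> (\<lambda>(j, a). comp (r (j, a), j)) ` S"
          using s by force
      qed
    qed
  qed
  then have "card (blocks ?G c) = card S"
    by (simp add: blocks_eq bij_betw_same_card)
  moreover have "finite P"
    by (rule finite_subset[of _ "{..<n} \<times> {..<k}"]) (auto simp: P_def)
  moreover have "Q' \<subseteq> P"
    by (auto simp: Q'_def Q_def P_def)
  moreover have "card Q' = card Q"
    unfolding Q'_def by (rule card_image) (auto simp: inj_on_def)
  ultimately have "card (blocks ?G c) + card Q = card P"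
    unfolding S_def by (metis card_Diff_subset card_mono finite_subset le_add_diff_inverse2)
  then show ?thesis by (simp add: P_def Q_def)
qed

section \<open>Probabilities under a uniform coloring\<close>

text \<open>The extra family \<open>J\<close> makes the inclusion-exclusion step
  \<open>P(no I \<union> {x}, all J) = P(no I, all J) - P(no I, all J \<union> {x})\<close> an induction on \<open>I\<close>.\<close>

lemma prob_monochromatic_families:
  fixes U :: "'i \<Rightarrow> 'a set" and k m a :: nat
  assumes "finite A" "k \<ge> 1" "a < k"
    and "finite I" "finite J" "I \<inter> J = {}"
    and "\<And>i. i \<in> I \<union> J \<Longrightarrow> U i \<subseteq> A \<and> card (U i) = m"
    and "disjoint_family_on U (I \<union> J)"
  shows "measure_pmf.prob (Pi_pmf A undefined (\<lambda>_. pmf_of_set {..<k}))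
      {c. (\<forall>i\<in>I. \<exists>v\<in>U i. c v \<noteq> a) \<and> (\<forall>i\<in>J. \<forall>v\<in>U i. c v = a)}
    = (1 - (1 / real k) ^ m) ^ card I * ((1 / real k) ^ m) ^ card J"
  using assms(4-8)
proof (induction I arbitrary: J rule: finite_induct)
  case empty
  let ?p = "pmf_of_set {..<k}"
  have W: "(\<Union>i\<in>J. U i) \<subseteq> A" using empty.prems by auto
  have ne: "{..<k} \<noteq> {}" using assms(2) by (auto simp: lessThan_empty_iff)
  have pa: "measure_pmf.prob ?p {a} = 1 / real k"
    using ne assms(3) by (simp add: measure_pmf_single)
  \<comment> \<open>With no family to avoid, the event is a product of conditions on single
    vertices: color \<open>a\<close> on the union, no restriction elsewhere. Independence then gives
    a factor \<open>1 / real k\<close> per vertex of the union.\<close>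
  have "{c. (\<forall>i\<in>J. \<forall>v\<in>U i. c v = a)} = Pi A (\<lambda>v. if v \<in> (\<Union>i\<in>J. U i) then {a} else UNIV)"
    using W by (auto simp: Pi_def split: if_splits)
  then have "measure_pmf.prob (Pi_pmf A undefined (\<lambda>_. ?p)) {c. (\<forall>i\<in>J. \<forall>v\<in>U i. c v = a)}
      = (\<Prod>v\<in>A. measure_pmf.prob ?p (if v \<in> (\<Union>i\<in>J. U i) then {a} else UNIV))"
    using assms(1) by (simp only: measure_Pi_pmf_Pi)
  also have "\<dots> = (\<Prod>v\<in>A. if v \<in> (\<Union>i\<in>J. U i) then 1 / real k else 1)"
    by (intro prod.cong) (auto simp: pa)
  also have "\<dots> = (1 / real k) ^ card (\<Union>i\<in>J. U i)"
    using assms(1) W by (simp only: prod.If_cases Collect_mem_eq Int_absorb1) simp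
  \<comment> \<open>Disjointness enters here: the union has exactly \<open>m * card J\<close>
    vertices.\<close>
  also have "card (\<Union>i\<in>J. U i) = (\<Sum>i\<in>J. card (U i))"
    using empty.prems assms(1)
    by (intro card_UN_disjoint') (auto intro: finite_subset)
  also have "\<dots> = m * card J" using empty.prems by simp
  finally show ?case by (simp add: power_mult)
next
  case (insert x I)
  let ?M = "Pi_pmf A undefined (\<lambda>_. pmf_of_set {..<k})"
  let ?E = "\<lambda>I J. {c. (\<forall>i\<in>I. \<exists>v\<in>U i. c v \<noteq> a) \<and> (\<forall>i\<in>J. \<forall>v\<in>U i. c v = a)}"
  have x: "x \<notin> J" using insert.prems by auto
  have 1: "measure_pmf.prob ?M (?E I J) =
      (1 - (1 / real k) ^ m) ^ card I * ((1 / real k) ^ m) ^ card J"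
    using insert.prems by (intro insert.IH) (auto intro: disjoint_family_on_mono[rotated])
  have 2: "measure_pmf.prob ?M (?E I (insert x J)) =
      (1 - (1 / real k) ^ m) ^ card I * ((1 / real k) ^ m) ^ card (insert x J)"
    using insert.prems insert.hyps by (intro insert.IH) auto
  have "?E (insert x I) J = ?E I J - ?E I (insert x J)" by auto
  moreover have "?E I (insert x J) \<subseteq> ?E I J" by auto
  ultimately have "measure_pmf.prob ?M (?E (insert x I) J) =
      measure_pmf.prob ?M (?E I J) - measure_pmf.prob ?M (?E I (insert x J))"
    by (simp only: measure_pmf.finite_measure_Diff sets_measure_pmf UNIV_I)
  then show ?case
    unfolding 1 2 using insert.hyps insert.prems x by (simp add: algebra_simps)
qed

text \<open>Complement of the event that no \<open>U i\<close> is entirely of color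
  \<open>a\<close>, which is the previous lemma with \<open>J\<close> empty.\<close>

lemma prob_exists_monochromatic:
  fixes U :: "'i \<Rightarrow> 'a set" and k m a :: nat
  assumes "finite A" "k \<ge> 1" "a < k" "finite I"
    and "\<And>i. i \<in> I \<Longrightarrow> U i \<subseteq> A \<and> card (U i) = m" "disjoint_family_on U I"
  shows "measure_pmf.prob (Pi_pmf A undefined (\<lambda>_. pmf_of_set {..<k}))
      {c. \<exists>i\<in>I. \<forall>v\<in>U i. c v = a} = 1 - (1 - (1 / real k) ^ m) ^ card I"
proof -
  let ?M = "Pi_pmf A undefined (\<lambda>_. pmf_of_set {..<k})"
  have "measure_pmf.prob ?M {c. \<forall>i\<in>I. \<exists>v\<in>U i. c v \<noteq> a} = (1 - (1 / real k) ^ m) ^ card I"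
    using prob_monochromatic_families[OF assms(1-4), of "{}" U m] assms(5,6) by simp
  moreover have "{c. \<exists>i\<in>I. \<forall>v\<in>U i. c v = a} = UNIV - {c. \<forall>i\<in>I. \<exists>v\<in>U i. c v \<noteq> a}" by auto
  ultimately show ?thesis
    using measure_pmf.prob_compl[of "{c. \<forall>i\<in>I. \<exists>v\<in>U i. c v \<noteq> a}" ?M] by simp
qed

section \<open>Linearity of expectation\<close>

text \<open>The cardinality is a sum of indicators, each integrable because the support is
  finite.\<close>

lemma expectation_card_Collect:
  fixes p :: "'a pmf"
  assumes "finite X" "finite (set_pmf p)"
  shows "measure_pmf.expectation p (\<lambda>c. real (card {x \<in> X. T x c}))
    = (\<Sum>x\<in>X. measure_pmf.prob p {c. T x c})"
proof -
  have "real (card {x \<in> X. T x c}) = (\<Sum>x\<in>X. indicator {c. T x c} c)" for c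
    using assms(1) by (simp add: indicator_def sum.If_cases Int_def)
  then show ?thesis
    using assms(2) by (simp add: Bochner_Integration.integral_sum integrable_measure_pmf_finite)
qed

text \<open>There are \<open>n * k\<close> classes and \<open>(n - 1) * k\<close> consecutive pairs,
  and within each kind the probability is constant. With truncated \<open>n - 1\<close> this also
  covers \<open>n = 0\<close>.\<close>

lemma expected_blocks_complete_path:
  fixes k l n :: nat
  assumes "k \<ge> 1"
  shows "expected_blocks k (cartesian_product (complete_ugraph l) (path_ugraph n)) =
    real n * real k * (1 - (1 - 1 / real k) ^ l)
    - real (n - 1) * real k * (1 - (1 - (1 / real k)\<^sup>2) ^ l)"
proof -
  let ?G = "cartesian_product (complete_ugraph l) (path_ugraph n)"
  define A where "A = {..<l} \<times> {..<n}"
  define M where "M = Pi_pmf A undefined (\<lambda>_. pmf_of_set {..<k})"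
  \<comment> \<open>\<open>TP\<close> and \<open>TQ\<close> are phrased through sets of one and two
    vertices per row, disjoint for distinct rows, to fit \<open>prob_exists_monochromatic\<close>
    with \<open>m = 1\<close> and \<open>m = 2\<close>.\<close>
  define TP where "TP x c \<longleftrightarrow> (\<exists>i\<in>{..<l}. \<forall>v\<in>{(i, fst x)}. c v = snd x)"
    for x :: "nat \<times> nat" and c :: "nat \<times> nat \<Rightarrow> nat"
  define TQ where "TQ x c \<longleftrightarrow> (\<exists>i\<in>{..<l}. \<forall>v\<in>{(i, fst x), (i, Suc (fst x))}. c v = snd x)"
    for x :: "nat \<times> nat" and c :: "nat \<times> nat \<Rightarrow> nat"
  have finA: "finite A" by (simp add: A_def)
  have ne: "{..<k} \<noteq> {}" using assms by (auto simp: lessThan_empty_iff)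
  have M: "random_coloring k ?G = M"
    by (simp add: random_coloring_def M_def A_def cartesian_product_def complete_ugraph_def
        path_ugraph_def)
  have finM: "finite (set_pmf M)"
    unfolding M_def using finA ne by (simp add: set_Pi_pmf finite_PiE_dflt)
  \<comment> \<open>Restricted to the support, where all vertex colors are below \<open>k\<close>;
    equality almost everywhere is enough for the expectation.\<close>
  have card_eq: "real (card (blocks ?G c)) =
      real (card {x \<in> {..<n} \<times> {..<k}. TP x c}) - real (card {x \<in> {..<n - 1} \<times> {..<k}. TQ x c})"
    if "c \<in> set_pmf M" for c
  proof -
    have "c (i, j) < k" if "i < l" "j < n" for i j
      using \<open>c \<in> set_pmf M\<close> that finA ne by (auto simp: M_def set_Pi_pmf PiE_dflt_def A_def)
    then have "card (blocks ?G c)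
        + card {(j, a). j < n - 1 \<and> a < k \<and> (\<exists>i<l. c (i, j) = a \<and> c (i, Suc j) = a)}
      = card {(j, a). j < n \<and> a < k \<and> (\<exists>i<l. c (i, j) = a)}"
      by (rule card_blocks_complete_path)
    moreover have "{(j, a). j < n \<and> a < k \<and> (\<exists>i<l. c (i, j) = a)} = {x \<in> {..<n} \<times> {..<k}. TP x c}"
      "{(j, a). j < n - 1 \<and> a < k \<and> (\<exists>i<l. c (i, j) = a \<and> c (i, Suc j) = a)}
        = {x \<in> {..<n - 1} \<times> {..<k}. TQ x c}"
      by (auto simp: TP_def TQ_def)
    ultimately have "card (blocks ?G c) + card {x \<in> {..<n - 1} \<times> {..<k}. TQ x c}
        = card {x \<in> {..<n} \<times> {..<k}. TP x c}"
      by (simp only:)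
    then show ?thesis by linarith
  qed
  have P: "measure_pmf.prob M {c. TP x c} = 1 - (1 - 1 / real k) ^ l"
    if "x \<in> {..<n} \<times> {..<k}" for x
    unfolding M_def TP_def
    using prob_exists_monochromatic[of A k "snd x" "{..<l}" "\<lambda>i. {(i, fst x)}" 1] that assms finA
    by (auto simp: A_def disjoint_family_on_def)
  have Q: "measure_pmf.prob M {c. TQ x c} = 1 - (1 - (1 / real k)\<^sup>2) ^ l"
    if "x \<in> {..<n - 1} \<times> {..<k}" for x
    unfolding M_def TQ_def
    by (subst prob_exists_monochromatic[where m = 2])
      (use that assms finA in \<open>auto simp: A_def disjoint_family_on_def\<close>)
  have "expected_blocks k ?G = measure_pmf.expectation M (\<lambda>c.
      real (card {x \<in> {..<n} \<times> {..<k}. TP x c}) - real (card {x \<in> {..<n - 1} \<times> {..<k}. TQ x c}))"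
    unfolding expected_blocks_def M
    by (intro integral_cong_AE) (simp_all add: AE_measure_pmf_iff card_eq)
  also have "\<dots> = (\<Sum>x\<in>{..<n} \<times> {..<k}. measure_pmf.prob M {c. TP x c})
      - (\<Sum>x\<in>{..<n - 1} \<times> {..<k}. measure_pmf.prob M {c. TQ x c})"
    by (simp add: Bochner_Integration.integral_diff integrable_measure_pmf_finite finM
        expectation_card_Collect)
  also have "\<dots> = real n * real k * (1 - (1 - 1 / real k) ^ l)
      - real (n - 1) * real k * (1 - (1 - (1 / real k)\<^sup>2) ^ l)"
    by (simp add: P Q del: mem_Sigma_iff)
  finally show ?thesis .
qed

section \<open>Rewriting to the closed form\<close>

theorem theorem6p8:
  fixes k l n :: nat
  assumes "k \<ge> 1" and "l \<ge> 1" and "n \<ge> 1"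
  shows "expected_blocks k (cartesian_product (complete_ugraph l) (path_ugraph n)) =
    real k powi (int l * int n - (2 * int l - 1)) *
      ((real k ^ (2 * l) - ((real k)\<^sup>2 - 1) ^ l)
        + (real k - 1) ^ l * ((real k + 1) ^ l - real k ^ l) * real n)
    / real k ^ (l * n)"
proof -
  define K where "K = real k"
  have K: "K > 0" using assms by (simp add: K_def)
  \<comment> \<open>The exponent is negative when \<open>n = 1\<close> and \<open>l > 1\<close>, so
    it is split as an integer difference, with \<open>K\<close> nonzero.\<close>
  have "K powi (int l * int n - (2 * int l - 1)) = K powi (int (l * n) + 1 - int (2 * l))"
    by (simp add: algebra_simps)
  also have "\<dots> = K ^ (l * n) * K / K ^ (2 * l)"
    using K by (simp only: power_int_diff power_int_add power_int_of_nat power_int_1_right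
        less_imp_neq[symmetric] simp_thms)
  finally have pow: "K powi (int l * int n - (2 * int l - 1)) = K ^ (l * n) * K / K ^ (2 * l)" .
  \<comment> \<open>\<open>p1\<close> and \<open>p2\<close> bring both probabilities over the common
    denominator \<open>K ^ (2 * l)\<close>.\<close>
  have p1: "(1 - 1 / K) ^ l = (K - 1) ^ l * K ^ l / K ^ (2 * l)"
  proof -
    have "1 - 1 / K = (K - 1) * K / K\<^sup>2" using K by (simp add: field_simps power2_eq_square)
    then show ?thesis by (simp add: power_divide power_mult_distrib power_mult)
  qed
  have p2: "(1 - (1 / K)\<^sup>2) ^ l = (K\<^sup>2 - 1) ^ l / K ^ (2 * l)"
  proof -
    have "1 - (1 / K)\<^sup>2 = (K\<^sup>2 - 1) / K\<^sup>2" using K by (simp add: field_simps)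
    then show ?thesis by (simp add: power_divide power_mult)
  qed
  have p3: "(K\<^sup>2 - 1) ^ l = (K - 1) ^ l * (K + 1) ^ l"
    by (simp add: power_mult_distrib[symmetric] algebra_simps power2_eq_square)
  \<comment> \<open>An identity in free variables, used with \<open>x\<close>, \<open>y\<close>,
    \<open>z\<close> as the \<open>l\<close>-th powers of \<open>K - 1\<close>,
    \<open>K + 1\<close>, \<open>K\<close>, with \<open>w = K ^ (2 * l)\<close> and
    \<open>u = K ^ (l * n)\<close>. The bound \<open>n \<ge> 1\<close> turns
    \<open>real (n - 1)\<close> into \<open>real n - 1\<close>.\<close>
  have "real n * K * (1 - x * z / w) - (real n - 1) * K * (1 - x * y / w) =
      u * K / w * ((w - x * y) + x * (y - z) * real n) / u"
    if "u > 0" "w > 0" for u w x y z :: real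
    using that by (simp add: field_simps)
  from this[of "K ^ (l * n)" "K ^ (2 * l)"] show ?thesis
    unfolding expected_blocks_complete_path[OF assms(1)] K_def[symmetric] pow p1 p2 p3
    using K assms(3) by (simp add: of_nat_diff)
qed

end
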